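(* Let $K_{m,n}$ be the complete bipartite graph with bipartition $(X,Y)$, $|X|=m$, $|Y|=n$. For integers $s,t$, let $\tau_{s,t}(K_{m,n})$ denote the number of spanning trees of $K_{m,n}$ containing all edges of a given tree $T\subseteq K_{m,n}$ with $|V(T)\cap X|=s$ and $|V(T)\cap Y|=t$ (this number depends only on $s$ and $t$). Then: (1) for any $1\le s\le m$ and $1\le t\le n-1$, $$\frac{\tau_{s,t+1}(K_{m,n})}{\tau_{s,t}(K_{m,n})}=\frac{sn+(m-s)(t+1)}{m[sn+(m-s)t]};$$ (2) for any $1\le s\le m-1$ and $1\le t\le n$, $$\frac{\tau_{s+1,t}(K_{m,n})}{\tau_{s,t}(K_{m,n})}=\frac{tm+(n-t)(s+1)}{n[tm+(n-t)s]}.$$ *)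

theory Defs
  imports Complex_Main
begin

(* Finite simple undirected graphs, given by a vertex set V and a set E of
   two-element subsets of V. (In a digraph encoding with one arc per direction, every
   edge would give a closed directed walk of length 2, so directed acyclicity
   is not the right notion for undirected trees.) *)

definition simple_graph :: "'a set \<Rightarrow> 'a set set \<Rightarrow> bool" where
  "simple_graph V E \<longleftrightarrow> finite V \<and> (\<forall>e\<in>E. e \<subseteq> V \<and> card e = 2)"

definition adjacency :: "'a set set \<Rightarrow> 'a rel" where
  "adjacency E = {(u, v). {u, v} \<in> E}"

definition graph_connected :: "'a set \<Rightarrow> 'a set set \<Rightarrow> bool" where
  "graph_connected V E \<longleftrightarrow> V \<noteq> {} \<and> (\<forall>u\<in>V. \<forall>v\<in>V. (u, v) \<in> (adjacency E)\<^sup>*)"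

definition graph_cycle :: "'a set set \<Rightarrow> 'a list \<Rightarrow> bool" where
  "graph_cycle E c \<longleftrightarrow> 3 \<le> length c \<and> distinct c \<and>
     (\<forall>i<length c. {c ! i, c ! (Suc i mod length c)} \<in> E)"

definition graph_acyclic :: "'a set set \<Rightarrow> bool" where
  "graph_acyclic E \<longleftrightarrow> (\<nexists>c. graph_cycle E c)"

definition is_tree :: "'a set \<Rightarrow> 'a set set \<Rightarrow> bool" where
  "is_tree V E \<longleftrightarrow> simple_graph V E \<and> graph_connected V E \<and> graph_acyclic E"

definition is_subgraph :: "'a set \<Rightarrow> 'a set set \<Rightarrow> 'a set \<Rightarrow> 'a set set \<Rightarrow> bool" where
  "is_subgraph V' E' V E \<longleftrightarrow> V' \<subseteq> V \<and> E' \<subseteq> E"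

(* A spanning subgraph of (V, E) is determined by its edge set F. *)
definition spanning_trees :: "'a set \<Rightarrow> 'a set set \<Rightarrow> 'a set set set" where
  "spanning_trees V E = {F. is_subgraph V F V E \<and> is_tree V F}"

definition bipartite_edges :: "'a set \<Rightarrow> 'a set \<Rightarrow> 'a set set" where
  "bipartite_edges X Y = {{x, y} | x y. x \<in> X \<and> y \<in> Y}"

definition subtree_of_type ::
  "'a set \<Rightarrow> 'a set \<Rightarrow> nat \<Rightarrow> nat \<Rightarrow> 'a set \<Rightarrow> 'a set set \<Rightarrow> bool" where
  "subtree_of_type X Y s t VT ET \<longleftrightarrow>
     is_tree VT ET \<and> is_subgraph VT ET (X \<union> Y) (bipartite_edges X Y) \<and>
     card (VT \<inter> X) = s \<and> card (VT \<inter> Y) = t"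

definition num_spanning_trees_containing :: "'a set \<Rightarrow> 'a set \<Rightarrow> 'a set set \<Rightarrow> nat" where
  "num_spanning_trees_containing X Y ET =
     card {F \<in> spanning_trees (X \<union> Y) (bipartite_edges X Y). ET \<subseteq> F}"

(* The common value over all subtrees T with s vertices in X and t in Y; that it
   exists is the claim that the number depends only on s and t. *)
definition tau :: "'a set \<Rightarrow> 'a set \<Rightarrow> nat \<Rightarrow> nat \<Rightarrow> nat" where
  "tau X Y s t = (THE k. \<forall>VT ET. subtree_of_type X Y s t VT ET \<longrightarrow>
     num_spanning_trees_containing X Y ET = k)"

end

theory Submission
  imports Defs
begin

text \<open>
  For a forest \<open>F\<close> in the complete bipartite graph, whose components \<open>C\<close> have \<open>s C\<close> vertices
  in \<open>X\<close> and \<open>t C\<close> in \<open>Y\<close>, let \<open>a C = n * s C + m * t C\<close>. The number \<open>N F\<close> of spanning trees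
  containing \<open>F\<close> satisfies
  \<open>m * n * N F = (\<Prod>C. a C) * (1 - (\<Sum>C. s C * t C / a C))\<close>.
  This is proved by induction on the number \<open>k\<close> of components: every spanning tree containing \<open>F\<close>
  has exactly \<open>k - 1\<close> further edges, so summing \<open>N (insert e F)\<close> over the edges \<open>e\<close> joining
  different components gives \<open>(k - 1) * N F\<close>, and the right-hand side obeys the same recursion.
  For a single tree of type \<open>(s, t)\<close> and isolated vertices the formula reads
  \<open>m * n * N F = n ^ (m - s) * m ^ (n - t) * (s * n + (m - s) * t)\<close>.
\<close>

section \<open>Reachability and cycles in edge sets\<close>

abbreviation conn :: "'a set set \<Rightarrow> 'a rel" where
  "conn E \<equiv> (adjacency E)\<^sup>*"

lemma sym_conn: "sym (conn E)"
  by (intro sym_rtrancl) (auto simp: sym_def adjacency_def insert_commute)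

lemma conn_commute: "(u, v) \<in> conn E \<Longrightarrow> (v, u) \<in> conn E"
  using sym_conn by (metis symD)

lemma edge_conn: "{u, v} \<in> E \<Longrightarrow> (u, v) \<in> conn E"
  by (auto simp: adjacency_def)

lemma graph_acyclic_subset: "graph_acyclic F \<Longrightarrow> E \<subseteq> F \<Longrightarrow> graph_acyclic E"
  unfolding graph_acyclic_def graph_cycle_def by blast

lemma graph_acyclic_empty: "graph_acyclic {}"
proof -
  have "\<not> graph_cycle {} c" for c :: "'a list"
    unfolding graph_cycle_def by (cases c) auto
  then show ?thesis by (simp add: graph_acyclic_def)
qed

text \<open>Grow the path one edge at a time; when the next vertex already lies on it, cut the path
  back to that vertex. Distinctness is what later lets such a path be closed to a cycle.\<close>

lemma conn_distinct_path:
  assumes "(u, v) \<in> conn E"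
  obtains p where "p \<noteq> []" "distinct p" "hd p = u" "last p = v"
    "\<forall>i. Suc i < length p \<longrightarrow> {p ! i, p ! Suc i} \<in> E"
proof -
  have "\<exists>p. p \<noteq> [] \<and> distinct p \<and> hd p = u \<and> last p = v \<and>
      (\<forall>i. Suc i < length p \<longrightarrow> {p ! i, p ! Suc i} \<in> E)"
    using assms
  proof (induction rule: rtrancl_induct)
    case base
    show ?case by (rule exI[of _ "[u]"]) simp
  next
    case (step y z)
    then obtain p where p: "p \<noteq> []" "distinct p" "hd p = u" "last p = y"
      "\<forall>i. Suc i < length p \<longrightarrow> {p ! i, p ! Suc i} \<in> E" by blast
    show ?case
    proof (cases "z \<in> set p")
      case True
      then obtain j where j: "j < length p" "p ! j = z" by (auto simp: in_set_conv_nth)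
      then have "take (Suc j) p \<noteq> []" "hd (take (Suc j) p) = u" "last (take (Suc j) p) = z"
        using p(1,3) by (simp, simp add: hd_take, simp add: take_Suc_conv_app_nth)
      then show ?thesis using p by (intro exI[of _ "take (Suc j) p"]) auto
    next
      case False
      have "{(p @ [z]) ! i, (p @ [z]) ! Suc i} \<in> E" if "Suc i < length (p @ [z])" for i
      proof (cases "Suc i < length p")
        case True
        then show ?thesis using p(5) by (auto simp: nth_append)
      next
        case False
        with that have "i = length p - 1" "Suc i = length p" using p(1) by auto
        then show ?thesis using step(2) p(1,4)
          by (auto simp: nth_append last_conv_nth adjacency_def)
      qed
      then show ?thesis using False p by (intro exI[of _ "p @ [z]"]) auto
    qed
  qed
  then show ?thesis using that by blast
qed

text \<open>The edge \<open>{u, v}\<close> would close a simple path from \<open>u\<close> to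
  \<open>v\<close> to a cycle. The path has at least three vertices: one would give
  \<open>u = v\<close>, two would put \<open>{u, v}\<close> into \<open>E\<close>.\<close>

lemma not_conn_of_acyclic_insert:
  assumes "graph_acyclic (insert {u, v} E)" "{u, v} \<notin> E" "u \<noteq> v"
  shows "(u, v) \<notin> conn E"
proof
  assume "(u, v) \<in> conn E"
  then obtain p where p: "p \<noteq> []" "distinct p" "hd p = u" "last p = v"
    "\<forall>i. Suc i < length p \<longrightarrow> {p ! i, p ! Suc i} \<in> E" by (rule conn_distinct_path)
  have uv: "p ! 0 = u" "p ! (length p - 1) = v"
    using p by (simp_all add: hd_conv_nth last_conv_nth)
  have "length p \<noteq> 0" "length p \<noteq> 1" using p(1) uv assms(3) by auto
  moreover have "length p \<noteq> 2" using uv p(5) assms(2) by auto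
  ultimately have L: "3 \<le> length p" by linarith
  have "{p ! i, p ! (Suc i mod length p)} \<in> insert {u, v} E" if i: "i < length p" for i
  proof (cases "Suc i < length p")
    case True
    then show ?thesis using p(5) by auto
  next
    case False
    with i have "Suc i = length p" by simp
    then have "p ! i = v" "p ! (Suc i mod length p) = u" using uv by (metis diff_Suc_1, simp)
    then show ?thesis by (simp add: insert_commute)
  qed
  then have "graph_cycle (insert {u, v} E) p" using L p by (simp add: graph_cycle_def)
  then show False using assms(1) by (auto simp: graph_acyclic_def)
qed

text \<open>An edge of a cycle determines its position. Length 3 is essential: on two vertices both
  positions carry the same edge.\<close>

lemma cyclic_index_cong:
  assumes "distinct c" "3 \<le> length c" "i < length c" "j < length c"
    and "{c ! i, c ! (Suc i mod length c)} = {c ! j, c ! (Suc j mod length c)}"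
  shows "i = j"
proof (rule ccontr)
  assume ne: "i \<noteq> j"
  let ?L = "length c"
  have l: "Suc i mod ?L < ?L" "Suc j mod ?L < ?L" using assms(2) by (auto intro!: mod_less_divisor)
  have "c ! i = c ! (Suc j mod ?L)" "c ! j = c ! (Suc i mod ?L)"
    using assms ne by (auto simp: doubleton_eq_iff nth_eq_iff_index_eq)
  then have "i = Suc j mod ?L" "j = Suc i mod ?L"
    using assms(1,3,4) l by (simp_all add: nth_eq_iff_index_eq)
  moreover have "Suc k mod ?L = (if Suc k = ?L then 0 else Suc k)" if "k < ?L" for k
    using that by (simp add: mod_Suc)
  ultimately show False using assms(2,3,4) by (simp split: if_splits)
qed

text \<open>A cycle created by the new edge uses it exactly once, so the rest of the cycle already
  connects \<open>u\<close> and \<open>v\<close> in \<open>E\<close>.\<close>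

lemma acyclic_insert_of_not_conn:
  assumes ac: "graph_acyclic E" and nc: "(u, v) \<notin> conn E"
  shows "graph_acyclic (insert {u, v} E)"
  unfolding graph_acyclic_def
proof
  assume "\<exists>c. graph_cycle (insert {u, v} E) c"
  then obtain c where c: "graph_cycle (insert {u, v} E) c" by blast
  let ?L = "length c"
  let ?e = "\<lambda>i. {c ! i, c ! (Suc i mod ?L)}"
  have L: "3 \<le> ?L" "distinct c" and e: "\<And>i. i < ?L \<Longrightarrow> ?e i \<in> insert {u, v} E"
    using c by (auto simp: graph_cycle_def)
  have "\<not> graph_cycle E c" using ac by (auto simp: graph_acyclic_def)
  then obtain i where i: "i < ?L" "?e i \<notin> E" using L by (auto simp: graph_cycle_def)
  then have ei: "?e i = {u, v}" using e by blast
  have other: "?e j \<in> E" if "j < ?L" "j \<noteq> i" for j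
    using e[OF that(1)] cyclic_index_cong[OF L(2,1) that(1) i(1)] that(2) ei by auto
  \<comment> \<open>Walk round the cycle from the vertex after position \<open>i\<close>. Fewer than
    \<open>?L\<close> steps never traverse the edge at position \<open>i\<close>, so all edges used
    lie in \<open>E\<close>.\<close>
  have "k < ?L \<Longrightarrow> (c ! (Suc i mod ?L), c ! ((Suc i + k) mod ?L)) \<in> conn E" for k
  proof (induction k)
    case (Suc k)
    let ?j = "(Suc i + k) mod ?L"
    have "?j \<noteq> i"
    proof (cases "Suc i + k < ?L")
      case False
      then have "?j = Suc i + k - ?L" using Suc.prems i(1) by (simp add: mod_if)
      then show ?thesis using Suc.prems False by linarith
    qed simp
    moreover have "?j < ?L" using L(1) by (intro mod_less_divisor) linarith
    ultimately have "?e ?j \<in> E" by (intro other)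
    moreover have "Suc ?j mod ?L = (Suc i + Suc k) mod ?L"
      by (simp add: mod_Suc_eq)
    ultimately have "(c ! ?j, c ! ((Suc i + Suc k) mod ?L)) \<in> conn E"
      by (metis edge_conn)
    then show ?case using Suc by (meson Suc_lessD rtrancl_trans)
  qed simp
  \<comment> \<open>After \<open>?L - 1\<close> steps the walk reaches \<open>c ! i\<close>, the
    other end of the removed edge.\<close>
  from this[of "?L - 1"] have "(c ! (Suc i mod ?L), c ! ((Suc i + (?L - 1)) mod ?L)) \<in> conn E"
    using i(1) by simp
  moreover have "Suc i + (?L - 1) = i + ?L" using i(1) by simp
  ultimately have "(c ! (Suc i mod ?L), c ! i) \<in> conn E" using i(1) by simp
  then have "(u, v) \<in> conn E" using ei conn_commute by (auto simp: doubleton_eq_iff)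
  with nc show False ..
qed

subsection \<open>Connected components of a forest\<close>

definition component :: "'a set set \<Rightarrow> 'a \<Rightarrow> 'a set" where
  "component E v = conn E `` {v}"

definition components :: "'a set \<Rightarrow> 'a set set \<Rightarrow> 'a set set" where
  "components V E = component E ` V"

lemma mem_component: "w \<in> component E v \<longleftrightarrow> (v, w) \<in> conn E"
  by (simp add: component_def)

lemma component_self [simp]: "v \<in> component E v"
  by (simp add: mem_component)

lemma component_eq_iff: "component E u = component E v \<longleftrightarrow> (u, v) \<in> conn E"
proof
  assume "component E u = component E v"
  then have "u \<in> component E v" using component_self by fastforce
  then show "(u, v) \<in> conn E" by (simp add: mem_component conn_commute)
next
  assume uv: "(u, v) \<in> conn E"
  then show "component E u = component E v"
    by (meson conn_commute mem_component rtrancl_trans subsetI subset_antisym)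
qed

lemma component_eq_of_mem: "w \<in> component E v \<Longrightarrow> component E w = component E v"
  by (simp add: mem_component component_eq_iff conn_commute)

lemma component_disjoint: "component E u \<noteq> component E v \<Longrightarrow> component E u \<inter> component E v = {}"
  by (metis component_eq_of_mem disjoint_iff)

lemma component_subset:
  assumes "\<Union>E \<subseteq> V" "v \<in> V"
  shows "component E v \<subseteq> V"
proof
  fix w assume "w \<in> component E v"
  then have "(v, w) \<in> conn E" by (simp add: mem_component)
  then show "w \<in> V"
    by (induction rule: rtrancl_induct) (use assms in \<open>auto simp: adjacency_def\<close>)
qed

lemma component_insert:
  "component (insert {u, v} E) w =
     (if w \<in> component E u \<union> component E v then component E u \<union> component E v
      else component E w)"
proof -
  have adj: "adjacency (insert {u, v} E) = insert (u, v) (insert (v, u) (adjacency E))"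
    by (auto simp: adjacency_def doubleton_eq_iff)
  \<comment> \<open>A path through the new edge can be shortened to cross it only once, in one of
    two directions.\<close>
  have eq: "(w, x) \<in> conn (insert {u, v} E) \<longleftrightarrow> (w, x) \<in> conn E \<or>
      (w, u) \<in> conn E \<and> (v, x) \<in> conn E \<or> (w, v) \<in> conn E \<and> (u, x) \<in> conn E" for x
    unfolding adj rtrancl_insert
    by (auto intro: rtrancl_trans)
  show ?thesis
    unfolding set_eq_iff mem_component eq
    by (auto simp: mem_component intro: conn_commute rtrancl_trans)
qed

text \<open>The components at both ends of the edge are fused. Stated with a set difference, this
  also covers an edge inside one component, where nothing changes.\<close>

lemma components_insert:
  assumes "u \<in> V" "v \<in> V"
  shows "components V (insert {u, v} E) =
    insert (component E u \<union> component E v) (components V E - {component E u, component E v})"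
    (is "?l = insert ?U ?R")
proof
  show "?l \<subseteq> insert ?U ?R"
  proof
    fix C assume "C \<in> ?l"
    then obtain w where w: "w \<in> V" "C = component (insert {u, v} E) w"
      by (auto simp: components_def)
    show "C \<in> insert ?U ?R"
    proof (cases "w \<in> ?U")
      case False
      then have "component E w \<noteq> component E u" "component E w \<noteq> component E v"
        by (metis UnI1 component_self, metis UnI2 component_self)
      then show ?thesis using False w by (auto simp: component_insert components_def)
    qed (simp add: w component_insert)
  qed
  have "?U \<in> ?l" unfolding components_def
    using assms(1) by (intro image_eqI[of _ _ u]) (auto simp: component_insert)
  moreover have "component E w \<in> ?l"
    if w: "w \<in> V" "component E w \<noteq> component E u" "component E w \<noteq> component E v" for w
  proof -
    have "component (insert {u, v} E) w = component E w"
      using w component_eq_of_mem[of w E] by (auto simp: component_insert)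
    then show ?thesis using w(1) by (force simp: components_def)
  qed
  ultimately show "insert ?U ?R \<subseteq> ?l" by (auto simp: components_def)
qed

text \<open>Ensures that the fused component is a new element, so that counts, sums and products
  over the components change as expected.\<close>

lemma union_component_notin_components:
  assumes "component E u \<noteq> component E v"
  shows "component E u \<union> component E v \<notin> components V E"
proof
  assume "component E u \<union> component E v \<in> components V E"
  then obtain w where w: "component E w = component E u \<union> component E v"
    by (auto simp: components_def)
  then have "u \<in> component E w" "v \<in> component E w" by auto
  then show False using assms by (metis component_eq_of_mem)
qed

lemma card_components_insert:
  assumes "finite V" "u \<in> V" "v \<in> V" "component E u \<noteq> component E v"
  shows "Suc (card (components V (insert {u, v} E))) = card (components V E)"
proof -
  have fin: "finite (components V E)" using assms(1) by (simp add: components_def)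
  have sub: "{component E u, component E v} \<subseteq> components V E"
    using assms by (auto simp: components_def)
  have "card {component E u, component E v} = 2" using assms(4) by simp
  moreover have "2 \<le> card (components V E)"
    using card_mono[OF fin sub] calculation by simp
  ultimately show ?thesis
    using fin sub union_component_notin_components[OF assms(4), of V] assms(2,3)
    by (simp add: components_insert card_Diff_subset)
qed

lemma component_empty: "component {} v = {v}"
  by (auto simp: component_def adjacency_def)

text \<open>Starting from singletons, each edge of a forest joins two different components and
  lowers their number by exactly one.\<close>

lemma card_components_forest:
  assumes V: "finite V" and E: "finite E" and "graph_acyclic E"
    and "\<And>e. e \<in> E \<Longrightarrow> e \<subseteq> V \<and> card e = 2"
  shows "card (components V E) + card E = card V"
  using E assms(3,4)
proof (induction E rule: finite_induct)
  case empty
  have "inj_on (component {}) V" by (auto simp: inj_on_def component_empty)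
  then show ?case by (simp add: components_def card_image)
next
  case (insert e E)
  obtain u v where e: "e = {u, v}" "u \<noteq> v" "u \<in> V" "v \<in> V"
    using insert.prems(2)[of e] by (auto simp: card_2_iff)
  have "(u, v) \<notin> conn E"
    using insert.prems(1) insert.hyps(2) e by (intro not_conn_of_acyclic_insert) auto
  then have "component E u \<noteq> component E v" by (simp add: component_eq_iff)
  from card_components_insert[OF V e(3,4) this]
  show ?case using insert.IH insert.prems insert.hyps e(1)
    by (simp add: graph_acyclic_subset[OF insert.prems(1)] subset_insertI)
qed

lemma card_components_eq_1_iff:
  assumes "finite V"
  shows "card (components V E) = 1 \<longleftrightarrow> graph_connected V E"
proof -
  have "card (components V E) = 1 \<longleftrightarrow> (\<exists>C. components V E = {C})"
    by (simp add: card_1_singleton_iff)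
  also have "\<dots> \<longleftrightarrow> V \<noteq> {} \<and> (\<forall>u\<in>V. \<forall>v\<in>V. component E u = component E v)"
  proof
    assume "\<exists>C. components V E = {C}"
    then obtain C where "component E ` V = {C}" by (auto simp: components_def)
    then show "V \<noteq> {} \<and> (\<forall>u\<in>V. \<forall>v\<in>V. component E u = component E v)"
      by (metis image_eqI image_is_empty insert_not_empty singletonD)
  next
    assume *: "V \<noteq> {} \<and> (\<forall>u\<in>V. \<forall>v\<in>V. component E u = component E v)"
    then obtain v where "v \<in> V" by blast
    with * have "components V E = {component E v}" unfolding components_def by blast
    then show "\<exists>C. components V E = {C}" ..
  qed
  also have "\<dots> \<longleftrightarrow> graph_connected V E"
    by (auto simp: graph_connected_def component_eq_iff)
  finally show ?thesis .
qed

subsection \<open>The recursion satisfied by the weight of a forest\<close>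

text \<open>
  With \<open>i\<close>, \<open>j\<close> ranging over the components of a forest, the bracket is the weight of the
  forest after merging \<open>i\<close> and \<open>j\<close>, divided by the product of all the \<open>a i\<close>. The full double
  sum factorises; the diagonal, excluded here, contributes \<open>2 * Q * (1 - Q)\<close> to it.
\<close>

lemma merging_sum_identity:
  fixes s t :: "'i \<Rightarrow> real" and m n :: real
  defines "a \<equiv> \<lambda>i. n * s i + m * t i"
  assumes P: "finite P" and pos: "\<And>i. i \<in> P \<Longrightarrow> a i > 0"
    and m: "(\<Sum>i\<in>P. s i) = m" and n: "(\<Sum>i\<in>P. t i) = n" and mn: "m > 0" "n > 0"
  defines "Q \<equiv> 1 - (\<Sum>i\<in>P. s i * t i / a i)"
  shows "(\<Sum>i\<in>P. \<Sum>j\<in>P. if i = j then 0 else s i * t j *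
      ((1 / a i + 1 / a j) * (Q + s i * t i / a i + s j * t j / a j)
        - (s i + s j) * (t i + t j) / (a i * a j))) = (real (card P) - 1) * Q"
proof -
  let ?p = "\<lambda>i. s i / a i" and ?q = "\<lambda>i. t i / a i" and ?b = "\<lambda>i. s i * t i / a i"
  let ?g = "\<lambda>i j. s i * t j *
      ((1 / a i + 1 / a j) * (Q + s i * t i / a i + s j * t j / a j)
        - (s i + s j) * (t i + t j) / (a i * a j))"
  have b: "(\<Sum>i\<in>P. ?b i) = 1 - Q" by (simp add: Q_def)
  have diag: "?g i i = 2 * Q * ?b i" if "i \<in> P" for i
    using pos[OF that] by (simp add: field_simps)
  \<comment> \<open>The terms \<open>s i * ?b i * ?q j\<close> and \<open>?p i * t j * ?b j\<close>
    cancel. Every remaining term is a function of \<open>i\<close> times a function of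
    \<open>j\<close>, so the double sum factorises.\<close>
  have g: "?g i j = Q * (?p i * t j) + Q * (s i * ?q j)
      + (s i * ?b i / a i) * t j + s i * (t j * ?b j / a j)
      - (s i * ?p i) * (t j * ?q j) - ?b i * ?b j" if "i \<in> P" "j \<in> P" for i j
    using pos[OF that(1)] pos[OF that(2)] by (simp add: field_simps)
  \<comment> \<open>The definition of \<open>a\<close> divided by \<open>a i\<close>. Weighted with
    \<open>s i\<close>, \<open>t i\<close>, 1 and \<open>?b i\<close> and summed, it yields all the
    moments needed below.\<close>
  have one: "n * ?p i + m * ?q i = 1" if "i \<in> P" for i
  proof -
    have "n * ?p i + m * ?q i = a i / a i" unfolding a_def times_divide_eq_right add_divide_distrib ..
    then show ?thesis using pos[OF that] by simp
  qed
  define \<alpha> where "\<alpha> = (\<Sum>i\<in>P. s i * ?p i)"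
  define \<beta> where "\<beta> = (\<Sum>i\<in>P. t i * ?q i)"
  have "n * \<alpha> + m * (1 - Q) = (\<Sum>i\<in>P. s i * (n * ?p i + m * ?q i))"
    unfolding \<alpha>_def b[symmetric] by (simp add: sum_distrib_left sum.distrib algebra_simps)
  also have "\<dots> = m" using one by (simp add: m[symmetric])
  finally have \<alpha>: "n * \<alpha> = m * Q" by (simp add: algebra_simps)
  have "m * \<beta> + n * (1 - Q) = (\<Sum>i\<in>P. t i * (n * ?p i + m * ?q i))"
    unfolding \<beta>_def b[symmetric] by (simp add: sum_distrib_left sum.distrib algebra_simps)
  also have "\<dots> = n" using one by (simp add: n[symmetric])
  finally have \<beta>: "m * \<beta> = n * Q" by (simp add: algebra_simps)
  have "(n * \<alpha>) * (m * \<beta>) = (m * Q) * (n * Q)" by (simp only: \<alpha> \<beta>)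
  then have \<alpha>\<beta>: "\<alpha> * \<beta> = Q * Q" using mn by (simp add: field_simps)
  have pq: "n * (\<Sum>i\<in>P. ?p i) + m * (\<Sum>i\<in>P. ?q i) = card P"
    using one by (simp add: sum_distrib_left sum.distrib[symmetric])
  have "n * (\<Sum>i\<in>P. s i * ?b i / a i) + m * (\<Sum>i\<in>P. t i * ?b i / a i)
      = (\<Sum>i\<in>P. (n * ?p i + m * ?q i) * ?b i)"
    by (simp add: sum_distrib_left sum.distrib algebra_simps)
  also have "\<dots> = 1 - Q" using one b by simp
  finally have cub: "n * (\<Sum>i\<in>P. s i * ?b i / a i) + m * (\<Sum>i\<in>P. t i * ?b i / a i) = 1 - Q" .
  have "(\<Sum>i\<in>P. \<Sum>j\<in>P. ?g i j) = (\<Sum>i\<in>P. \<Sum>j\<in>P. Q * (?p i * t j) + Q * (s i * ?q j)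
      + (s i * ?b i / a i) * t j + s i * (t j * ?b j / a j)
      - (s i * ?p i) * (t j * ?q j) - ?b i * ?b j)"
    by (intro sum.cong refl g)
  also have "\<dots> = Q * ((\<Sum>i\<in>P. ?p i) * (\<Sum>i\<in>P. t i)) + Q * ((\<Sum>i\<in>P. s i) * (\<Sum>i\<in>P. ?q i))
      + (\<Sum>i\<in>P. s i * ?b i / a i) * (\<Sum>i\<in>P. t i) + (\<Sum>i\<in>P. s i) * (\<Sum>i\<in>P. t i * ?b i / a i)
      - (\<Sum>i\<in>P. s i * ?p i) * (\<Sum>i\<in>P. t i * ?q i) - (\<Sum>i\<in>P. ?b i) * (\<Sum>i\<in>P. ?b i)"
    by (simp only: sum_product) (simp only: sum_distrib_left sum.distrib sum_subtractf)
  also have "\<dots> = Q * (n * (\<Sum>i\<in>P. ?p i) + m * (\<Sum>i\<in>P. ?q i))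
      + (n * (\<Sum>i\<in>P. s i * ?b i / a i) + m * (\<Sum>i\<in>P. t i * ?b i / a i))
      - \<alpha> * \<beta> - (1 - Q) * (1 - Q)"
    unfolding m n b \<alpha>_def[symmetric] \<beta>_def[symmetric] by (simp only: algebra_simps)
  also have "\<dots> = Q * card P + (1 - Q) - Q * Q - (1 - Q) * (1 - Q)"
    by (simp only: pq cub \<alpha>\<beta>)
  finally have full: "(\<Sum>i\<in>P. \<Sum>j\<in>P. ?g i j) = Q * card P + (1 - Q) - Q * Q - (1 - Q) * (1 - Q)" .
  have "(\<Sum>j\<in>P. if i = j then 0 else ?g i j) = (\<Sum>j\<in>P. ?g i j) - ?g i i" if "i \<in> P" for i
  proof -
    have "(\<Sum>j\<in>P. if i = j then 0 else ?g i j) = (\<Sum>j\<in>P. ?g i j - (if i = j then ?g i i else 0))"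
      by (intro sum.cong) auto
    then show ?thesis using that P by (simp only: sum_subtractf sum.delta' if_True)
  qed
  then have "(\<Sum>i\<in>P. \<Sum>j\<in>P. if i = j then 0 else ?g i j) = (\<Sum>i\<in>P. (\<Sum>j\<in>P. ?g i j) - ?g i i)"
    by (intro sum.cong refl) blast
  also have "\<dots> = (\<Sum>i\<in>P. \<Sum>j\<in>P. ?g i j) - (\<Sum>i\<in>P. 2 * Q * ?b i)"
    using diag by (simp only: sum_subtractf cong: sum.cong)
  also have "(\<Sum>i\<in>P. 2 * Q * ?b i) = 2 * Q * (1 - Q)"
    by (simp only: sum_distrib_left[symmetric] b)
  \<comment> \<open>Here \<open>Q * Q + (1 - Q) * (1 - Q) + 2 * Q * (1 - Q) = 1\<close>, which
    leaves \<open>(card P - 1) * Q\<close>.\<close>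
  finally show ?thesis unfolding full by (simp add: algebra_simps)
qed

subsection \<open>Spanning trees of a complete bipartite graph containing a forest\<close>

locale complete_bipartite =
  fixes X Y :: "'a set"
  assumes finite_X: "finite X" and finite_Y: "finite Y" and disjoint: "X \<inter> Y = {}"
    and X_nonempty: "X \<noteq> {}" and Y_nonempty: "Y \<noteq> {}"
begin

abbreviation "V \<equiv> X \<union> Y"
abbreviation "B \<equiv> bipartite_edges X Y"
abbreviation "x_card A \<equiv> real (card (A \<inter> X))"
abbreviation "y_card A \<equiv> real (card (A \<inter> Y))"

text \<open>For a set of vertices this is the sum of their degrees in the complete bipartite
  graph.\<close>

definition weight :: "'a set \<Rightarrow> real" where
  "weight A = real (card Y) * x_card A + real (card X) * y_card A"

text \<open>A function of the family of components alone: the edges inside a component do not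
  influence the count.\<close>

definition forest_weight :: "'a set set \<Rightarrow> real" where
  "forest_weight P = (\<Prod>A\<in>P. weight A) * (1 - (\<Sum>A\<in>P. x_card A * y_card A / weight A))"

definition trees_containing :: "'a set set \<Rightarrow> 'a set set set" where
  "trees_containing F = {T. T \<subseteq> B \<and> graph_connected V T \<and> graph_acyclic T \<and> F \<subseteq> T}"

lemma card_X_pos: "card X > 0" and card_Y_pos: "card Y > 0"
  using finite_X finite_Y X_nonempty Y_nonempty by (simp_all add: card_gt_0_iff)

lemma edge_props: "e \<in> B \<Longrightarrow> e \<subseteq> V \<and> card e = 2"
  using disjoint by (auto simp: bipartite_edges_def card_insert_if)

lemma finite_B: "finite B"
  by (rule finite_subset[of _ "Pow V"]) (use edge_props finite_X finite_Y in auto)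

lemma num_spanning_trees_containing_eq:
  "num_spanning_trees_containing X Y F = card (trees_containing F)"
proof -
  have "{T \<in> spanning_trees V B. F \<subseteq> T} = trees_containing F"
    using edge_props finite_X finite_Y
    by (auto simp: spanning_trees_def is_subgraph_def is_tree_def simple_graph_def
      trees_containing_def)
  then show ?thesis by (simp add: num_spanning_trees_containing_def)
qed

lemma finite_trees_containing: "finite (trees_containing F)"
  by (rule finite_subset[of _ "Pow B"]) (auto simp: trees_containing_def finite_B)

lemma card_components:
  assumes "F \<subseteq> B" "graph_acyclic F"
  shows "card (components V F) + card F = card V"
  using assms finite_X finite_Y finite_B edge_props
  by (intro card_components_forest) (auto intro: finite_subset)

text \<open>Compare the forest identity \<open>card_components\<close> for \<open>F\<close> with the
  one for \<open>T\<close>, which has a single component.\<close>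

lemma card_tree_minus:
  assumes "F \<subseteq> B" "graph_acyclic F" "T \<in> trees_containing F"
  shows "card (T - F) = card (components V F) - 1"
proof -
  have T: "T \<subseteq> B" "graph_acyclic T" "graph_connected V T" "F \<subseteq> T"
    using assms(3) by (auto simp: trees_containing_def)
  have "card (components V T) = 1"
    using T(3) card_components_eq_1_iff[of V T] finite_X finite_Y by simp
  then have "1 + card T = card V" using card_components[OF T(1,2)] by simp
  moreover have "card (T - F) = card T - card F"
    using T finite_B by (intro card_Diff_subset) (auto intro: finite_subset)
  ultimately show ?thesis using card_components[OF assms(1,2)] by linarith
qed

text \<open>Base case of the count: a forest with one component leaves no edge to add.\<close>

lemma trees_containing_spanning_tree:
  assumes "F \<subseteq> B" "graph_acyclic F" "card (components V F) = 1"
  shows "trees_containing F = {F}"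
proof -
  have "T = F" if T: "T \<in> trees_containing F" for T
  proof -
    have "finite (T - F)" "F \<subseteq> T"
      using T finite_B by (auto simp: trees_containing_def intro: finite_subset)
    moreover have "card (T - F) = 0" using card_tree_minus[OF assms(1,2) T] assms(3) by simp
    ultimately show ?thesis by auto
  qed
  moreover have "graph_connected V F"
    using assms(3) card_components_eq_1_iff[of V F] finite_X finite_Y by simp
  ultimately show ?thesis using assms by (auto simp: trees_containing_def)
qed

section \<open>Double counting of one-edge extensions\<close>

lemma sum_over_edges: "(\<Sum>e\<in>B. f e) = (\<Sum>x\<in>X. \<Sum>y\<in>Y. f {x, y})"
proof -
  have "inj_on (\<lambda>(x, y). {x, y}) (X \<times> Y)"
    using disjoint by (auto simp: inj_on_def doubleton_eq_iff)
  moreover have "B = (\<lambda>(x, y). {x, y}) ` (X \<times> Y)"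
    by (auto simp: bipartite_edges_def)
  ultimately show ?thesis
    by (simp add: sum.reindex sum.cartesian_product case_prod_unfold)
qed

text \<open>Count the pairs of a spanning tree \<open>T\<close> containing \<open>F\<close> and an
  edge \<open>e\<close> of \<open>T - F\<close>, once by \<open>e\<close> and once by
  \<open>T\<close>.\<close>

lemma sum_trees_containing_insert:
  assumes "F \<subseteq> B" "graph_acyclic F"
  shows "(\<Sum>e\<in>B - F. card (trees_containing (insert e F))) =
    (card (components V F) - 1) * card (trees_containing F)"
proof -
  have "trees_containing (insert e F) = {T \<in> trees_containing F. e \<in> T}" for e
    by (auto simp: trees_containing_def)
  then have "(\<Sum>e\<in>B - F. card (trees_containing (insert e F))) =
      (\<Sum>e\<in>B - F. \<Sum>T | T \<in> trees_containing F \<and> e \<in> T. 1)" by simp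
  also have "\<dots> = (\<Sum>T\<in>trees_containing F. \<Sum>e | e \<in> B - F \<and> e \<in> T. 1)"
    using finite_B finite_trees_containing by (intro sum.swap_restrict) auto
  also have "\<dots> = (\<Sum>T\<in>trees_containing F. card (components V F) - 1)"
  proof (intro sum.cong refl)
    fix T assume T: "T \<in> trees_containing F"
    then have "{e. e \<in> B - F \<and> e \<in> T} = T - F" by (auto simp: trees_containing_def)
    then show "(\<Sum>e | e \<in> B - F \<and> e \<in> T. 1) = card (components V F) - 1"
      using card_tree_minus[OF assms T] by simp
  qed
  finally show ?thesis by simp
qed

text \<open>A new edge inside a component closes a cycle, so only edges between different components
  contribute to the recursion.\<close>

lemma trees_containing_insert_empty:
  assumes "component F x = component F y" "{x, y} \<notin> F" "x \<noteq> y"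
  shows "trees_containing (insert {x, y} F) = {}"
proof -
  have "\<not> graph_acyclic T" if "insert {x, y} F \<subseteq> T" for T
    using that assms not_conn_of_acyclic_insert[of x y F] graph_acyclic_subset[of T]
    by (auto simp: component_eq_iff)
  then show ?thesis by (auto simp: trees_containing_def)
qed

lemma weight_pos:
  assumes "A \<in> components V F"
  shows "weight A > 0"
proof -
  obtain v where v: "v \<in> V" "v \<in> A"
    using assms component_self unfolding components_def by (metis imageE)
  then have "card (A \<inter> X) > 0 \<or> card (A \<inter> Y) > 0"
    using finite_X finite_Y by (auto simp: card_gt_0_iff)
  then show ?thesis using card_X_pos card_Y_pos
    by (auto simp: weight_def add_pos_nonneg add_nonneg_pos)
qed

text \<open>Weights add under disjoint union, so merging replaces two factors by their sum and two
  summands by one. The full product over \<open>P\<close> is pulled out to give all merged pairs a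
  common factor and the bracket the shape of \<open>merging_sum_identity\<close>.\<close>

lemma forest_weight_merge:
  assumes P: "finite P" "A \<in> P" "A' \<in> P" "A \<noteq> A'" "A \<inter> A' = {}" "A \<union> A' \<notin> P"
    and pos: "\<And>C. C \<in> P \<Longrightarrow> weight C > 0"
  shows "forest_weight (insert (A \<union> A') (P - {A, A'})) =
    (\<Prod>C\<in>P. weight C) *
     ((1 / weight A + 1 / weight A') *
        (1 - (\<Sum>C\<in>P. x_card C * y_card C / weight C)
          + x_card A * y_card A / weight A + x_card A' * y_card A' / weight A')
      - (x_card A + x_card A') * (y_card A + y_card A') / (weight A * weight A'))"
proof -
  let ?R = "P - {A, A'}" and ?b = "\<lambda>C. x_card C * y_card C / weight C"
  have PR: "P = insert A (insert A' ?R)" "A \<notin> insert A' ?R" "A' \<notin> ?R" "finite ?R"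
    using P by auto
  have x: "x_card (A \<union> A') = x_card A + x_card A'"
    using P(5) finite_X by (subst Int_Un_distrib2, subst card_Un_disjoint) auto
  have y: "y_card (A \<union> A') = y_card A + y_card A'"
    using P(5) finite_Y by (subst Int_Un_distrib2, subst card_Un_disjoint) auto
  have w: "weight (A \<union> A') = weight A + weight A'"
    unfolding weight_def x y by (simp add: algebra_simps)
  have prod: "(\<Prod>C\<in>P. weight C) = weight A * (weight A' * (\<Prod>C\<in>?R. weight C))"
    using PR by (metis (no_types, lifting) finite_insert prod.insert)
  have sum: "(\<Sum>C\<in>P. ?b C) = ?b A + (?b A' + (\<Sum>C\<in>?R. ?b C))"
    using PR by (metis (no_types, lifting) finite_insert sum.insert)
  have "forest_weight (insert (A \<union> A') ?R) = (weight A + weight A') * (\<Prod>C\<in>?R. weight C) *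
      (1 - ((x_card A + x_card A') * (y_card A + y_card A') / (weight A + weight A')
        + (\<Sum>C\<in>?R. ?b C)))"
    unfolding forest_weight_def using PR(4) P(6) by (simp add: w x y)
  \<comment> \<open>\<open>p\<close> and \<open>q\<close> stand for the two weights,
    \<open>W\<close> and \<open>S\<close> for product and sum over the other components,
    \<open>u\<close> and \<open>v\<close> for the two replaced summands, \<open>z\<close> for the
    merged numerator.\<close>
  moreover have "(p + q) * W * (1 - (z / (p + q) + S)) =
      p * (q * W) * ((1 / p + 1 / q) * (1 - (u + (v + S)) + u + v) - z / (p * q))"
    if "p > 0" "q > 0" for p q W z S u v :: real
    using that by (simp add: field_simps)
  ultimately show ?thesis unfolding prod sum using pos P(2,3) by simp
qed

text \<open>Group the vertices by component. Applied to \<open>X\<close> and to \<open>Y\<close>,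
  this turns a sum over edges into one over pairs of components.\<close>

lemma sum_over_components:
  fixes f :: "'a set \<Rightarrow> real"
  assumes "U \<subseteq> V"
  shows "(\<Sum>u\<in>U. f (component F u)) = (\<Sum>A\<in>components V F. real (card (A \<inter> U)) * f A)"
proof -
  have fin: "finite U" "finite (components V F)"
    using assms finite_X finite_Y by (auto simp: components_def intro: finite_subset)
  have "(\<Sum>u\<in>U. f (component F u)) =
      (\<Sum>A\<in>components V F. \<Sum>u | u \<in> U \<and> component F u = A. f (component F u))"
    using fin assms by (intro sum.group[symmetric]) (auto simp: components_def)
  also have "\<dots> = (\<Sum>A\<in>components V F. real (card (A \<inter> U)) * f A)"
  proof (intro sum.cong refl)
    fix A assume "A \<in> components V F"
    then have "{u. u \<in> U \<and> component F u = A} = A \<inter> U"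
      using component_eq_of_mem by (fastforce simp: components_def)
    moreover have "(\<Sum>u | u \<in> U \<and> component F u = A. f (component F u)) =
        (\<Sum>u | u \<in> U \<and> component F u = A. f A)" by (intro sum.cong) auto
    ultimately show "(\<Sum>u | u \<in> U \<and> component F u = A. f (component F u)) = real (card (A \<inter> U)) * f A"
      by simp
  qed
  finally show ?thesis .
qed

lemma card_trees_containing:
  assumes "F \<subseteq> B" "graph_acyclic F"
  shows "real (card X) * real (card Y) * real (card (trees_containing F)) =
    forest_weight (components V F)"
  using assms
proof (induction "card (components V F)" arbitrary: F rule: less_induct)
  case less
  note F = less.prems
  let ?P = "components V F" and ?C = "component F"
  let ?W = "\<Prod>C\<in>?P. weight C"
  let ?mn = "real (card X) * real (card Y)"
  let ?N = "\<lambda>F. real (card (trees_containing F))"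
  have finP: "finite ?P" using finite_X finite_Y by (simp add: components_def)
  have "?P \<noteq> {}" using X_nonempty by (simp add: components_def)
  then have k: "card ?P \<ge> 1" using finP by (simp add: Suc_le_eq card_gt_0_iff)
  have sx: "(\<Sum>A\<in>?P. x_card A) = real (card X)" and sy: "(\<Sum>A\<in>?P. y_card A) = real (card Y)"
    using sum_over_components[of X "\<lambda>_. 1" F] sum_over_components[of Y "\<lambda>_. 1" F] by simp_all
  show ?case
  proof (cases "card ?P = 1")
    case True
    then obtain A where A: "?P = {A}" by (auto simp: card_1_singleton_iff)
    then have "x_card A = real (card X)" "y_card A = real (card Y)" using sx sy by simp_all
    \<comment> \<open>The single component has weight \<open>2 * ?mn\<close>, and the bracket is
      1/2.\<close>
    then have "forest_weight ?P = ?mn"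
      using card_X_pos card_Y_pos by (simp add: A forest_weight_def weight_def field_simps)
    then show ?thesis using trees_containing_spanning_tree[OF F True] by simp
  next
    case False
    define Q where "Q = 1 - (\<Sum>A\<in>?P. x_card A * y_card A / weight A)"
    define g where "g A A' = (1 / weight A + 1 / weight A') *
        (Q + x_card A * y_card A / weight A + x_card A' * y_card A' / weight A')
      - (x_card A + x_card A') * (y_card A + y_card A') / (weight A * weight A')" for A A'
    \<comment> \<open>An edge of \<open>F\<close> joins vertices of one component, so both sides
      vanish there; across components the induction hypothesis applies.\<close>
    have step: "?mn * (if {x, y} \<in> F then 0 else ?N (insert {x, y} F)) =
        (if ?C x = ?C y then 0 else ?W * g (?C x) (?C y))" if xy: "x \<in> X" "y \<in> Y" for x y
    proof (cases "?C x = ?C y")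
      case True
      moreover have "x \<noteq> y" using xy disjoint by auto
      ultimately show ?thesis using trees_containing_insert_empty[of F x y] by auto
    next
      case False
      then have nF: "{x, y} \<notin> F" using edge_conn[of x y F] by (auto simp: component_eq_iff)
      have V: "x \<in> V" "y \<in> V" using xy by auto
      have "?mn * ?N (insert {x, y} F) = forest_weight (components V (insert {x, y} F))"
      proof (rule less.hyps)
        show "card (components V (insert {x, y} F)) < card ?P"
          using card_components_insert[OF _ V False] finite_X finite_Y by simp
        show "insert {x, y} F \<subseteq> B" using xy F(1) by (auto simp: bipartite_edges_def)
        show "graph_acyclic (insert {x, y} F)"
          using F(2) False by (intro acyclic_insert_of_not_conn) (auto simp: component_eq_iff)
      qed
      also have "\<dots> = ?W * g (?C x) (?C y)"
        unfolding components_insert[OF V] g_def Q_def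
        using False component_disjoint[OF False] union_component_notin_components[OF False, of V]
          finP V weight_pos
        by (intro forest_weight_merge) (auto simp: components_def)
      finally show ?thesis using False nF by simp
    qed
    \<comment> \<open>Evaluate the double count: pass to all pairs \<open>x\<close>,
      \<open>y\<close>, group both by component, then apply the merging identity.\<close>
    have "?mn * ((real (card ?P) - 1) * ?N F) = ?mn * (\<Sum>e\<in>B - F. ?N (insert e F))"
      using sum_trees_containing_insert[OF F] k by (simp flip: of_nat_sum)
    also have "(\<Sum>e\<in>B - F. ?N (insert e F)) = (\<Sum>e\<in>B. if e \<in> F then 0 else ?N (insert e F))"
      using finite_B by (intro sum.mono_neutral_cong_left) auto
    also have "?mn * \<dots> = (\<Sum>x\<in>X. \<Sum>y\<in>Y. ?mn * (if {x, y} \<in> F then 0 else ?N (insert {x, y} F)))"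
      by (simp only: sum_over_edges sum_distrib_left)
    also have "\<dots> = (\<Sum>x\<in>X. \<Sum>y\<in>Y. if ?C x = ?C y then 0 else ?W * g (?C x) (?C y))"
      by (intro sum.cong refl step)
    also have "\<dots> = (\<Sum>x\<in>X. \<Sum>A'\<in>?P. y_card A' * (if ?C x = A' then 0 else ?W * g (?C x) A'))"
      using sum_over_components[of Y _ F] by (intro sum.cong refl) auto
    also have "\<dots> = (\<Sum>A\<in>?P. x_card A * (\<Sum>A'\<in>?P. y_card A' * (if A = A' then 0 else ?W * g A A')))"
      using sum_over_components[of X _ F] by auto
    also have "\<dots> = ?W * (\<Sum>A\<in>?P. \<Sum>A'\<in>?P. if A = A' then 0 else x_card A * y_card A' * g A A')"
      unfolding sum_distrib_left by (intro sum.cong refl) (simp add: mult_ac)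
    also have "(\<Sum>A\<in>?P. \<Sum>A'\<in>?P. if A = A' then 0 else x_card A * y_card A' * g A A') =
        (real (card ?P) - 1) * Q"
      unfolding g_def Q_def weight_def
      using finP sx sy weight_pos[of _ F] card_X_pos card_Y_pos
      by (intro merging_sum_identity) (auto simp: weight_def)
    finally have "(real (card ?P) - 1) * (?mn * ?N F) = (real (card ?P) - 1) * (?W * Q)"
      by (simp only: mult_ac)
    moreover have "real (card ?P) - 1 \<noteq> 0" using False by simp
    ultimately show ?thesis by (simp add: forest_weight_def Q_def)
  qed
qed

section \<open>A single tree together with isolated vertices\<close>

lemma components_subtree:
  assumes "is_tree VT ET" "VT \<subseteq> V"
  shows "components V ET = insert VT ((\<lambda>v. {v}) ` (V - VT))"
proof -
  have E: "\<Union>ET \<subseteq> VT" and ne: "VT \<noteq> {}"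
    and conn: "\<And>u v. u \<in> VT \<Longrightarrow> v \<in> VT \<Longrightarrow> (u, v) \<in> conn ET"
    using assms(1) by (auto simp: is_tree_def simple_graph_def graph_connected_def)
  have "component ET v = VT" if "v \<in> VT" for v
    using component_subset[OF E that] conn[OF that] by (auto simp: mem_component)
  moreover have "component ET v = {v}" if "v \<notin> VT" for v
  proof -
    have "w = v" if "(v, w) \<in> conn ET" for w
      using that by (induction rule: rtrancl_induct)
        (use E \<open>v \<notin> VT\<close> in \<open>auto simp: adjacency_def\<close>)
    then show ?thesis by (auto simp: mem_component)
  qed
  moreover have "V = VT \<union> (V - VT)" using assms(2) by blast
  ultimately show ?thesis using ne unfolding components_def
    by (subst \<open>V = _\<close>, subst image_Un) auto
qed

text \<open>Singletons contribute a factor \<open>card Y\<close> or \<open>card X\<close> to the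
  product and nothing to the sum, as they miss one side. The tree itself contributes
  \<open>weight VT - s * t\<close>.\<close>

lemma card_trees_containing_subtree:
  assumes T: "subtree_of_type X Y s t VT ET" and "s \<ge> 1" "t \<ge> 1"
  shows "real (card X) * real (card Y) * real (num_spanning_trees_containing X Y ET) =
    real (card Y) ^ (card X - s) * real (card X) ^ (card Y - t) *
    (real s * real (card Y) + (real (card X) - real s) * real t)"
proof -
  let ?m = "real (card X)" and ?n = "real (card Y)"
  have T': "is_tree VT ET" "VT \<subseteq> V" "ET \<subseteq> B" "graph_acyclic ET"
    and st: "card (VT \<inter> X) = s" "card (VT \<inter> Y) = t"
    using T by (auto simp: subtree_of_type_def is_subgraph_def is_tree_def)
  let ?S = "(\<lambda>v. {v}) ` (V - VT)"
  have fin: "finite (V - VT)" using finite_X finite_Y by simp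
  have VT: "VT \<notin> ?S"
    using st assms(2) by auto
  have w: "weight {v} = (if v \<in> X then ?n else ?m)" if "v \<in> V" for v
    using that disjoint by (auto simp: weight_def)
  have wVT: "weight VT = ?n * real s + ?m * real t" by (simp add: weight_def st)
  have pos: "weight VT > 0"
    using card_X_pos card_Y_pos assms(2,3) by (simp add: wVT add_pos_nonneg)
  have "V - VT = (X - VT) \<union> (Y - VT)" by auto
  then have "(\<Prod>v\<in>V - VT. weight {v}) = (\<Prod>v\<in>X - VT. weight {v}) * (\<Prod>v\<in>Y - VT. weight {v})"
    using finite_X finite_Y disjoint by (simp add: prod.union_disjoint disjoint_iff)
  also have "(\<Prod>v\<in>X - VT. weight {v}) = (\<Prod>v\<in>X - VT. ?n)"
    by (intro prod.cong refl) (auto simp: w)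
  also have "\<dots> = ?n ^ (card X - s)"
    using st(1) finite_X by (simp add: card_Diff_subset_Int Int_commute)
  also have "(\<Prod>v\<in>Y - VT. weight {v}) = (\<Prod>v\<in>Y - VT. ?m)"
    using disjoint by (intro prod.cong refl) (auto simp: w)
  also have "\<dots> = ?m ^ (card Y - t)"
    using st(2) finite_Y by (simp add: card_Diff_subset_Int Int_commute)
  finally have prod: "(\<Prod>A\<in>?S. weight A) = ?n ^ (card X - s) * ?m ^ (card Y - t)"
    by (simp add: prod.reindex)
  have "(\<Sum>A\<in>?S. x_card A * y_card A / weight A) = 0"
    using disjoint by (intro sum.neutral) auto
  then have "forest_weight (components V ET) =
      weight VT * (?n ^ (card X - s) * ?m ^ (card Y - t)) * (1 - real s * real t / weight VT)"
    unfolding components_subtree[OF T'(1,2)] forest_weight_def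
    using fin VT by (simp add: prod st)
  also have "\<dots> = ?n ^ (card X - s) * ?m ^ (card Y - t) * (weight VT - real s * real t)"
    using pos by (simp add: field_simps)
  also have "weight VT - real s * real t = real s * ?n + (?m - real s) * real t"
    by (simp add: wVT algebra_simps)
  finally show ?thesis
    using card_trees_containing[OF T'(3,4)] by (simp add: num_spanning_trees_containing_eq)
qed

end

subsection \<open>Trees of a given type\<close>

lemma exists_bipartite_tree:
  assumes fin: "finite S" "finite U" and ne: "S \<noteq> {}" "U \<noteq> {}" and disj: "S \<inter> U = {}"
  obtains E where "E \<subseteq> bipartite_edges S U" "is_tree (S \<union> U) E"
proof -
  interpret complete_bipartite S U using assms by unfold_locales
  \<comment> \<open>A maximal acyclic edge set is connected.\<close>
  let ?A = "{E. E \<subseteq> B \<and> graph_acyclic E}"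
  have "finite ?A" by (rule finite_subset[of _ "Pow B"]) (auto simp: finite_B)
  moreover have "?A \<noteq> {}" using graph_acyclic_empty by blast
  ultimately have "\<exists>E\<in>?A. \<forall>F\<in>?A. E \<subseteq> F \<longrightarrow> E = F" by (rule finite_has_maximal)
  then obtain E where "E \<in> ?A" and max: "\<And>F. F \<in> ?A \<Longrightarrow> E \<subseteq> F \<Longrightarrow> E = F"
    by (elim bexE) simp
  then have E: "E \<subseteq> B" "graph_acyclic E" by simp_all
  \<comment> \<open>Otherwise the edge \<open>{x, y}\<close> could be added without creating a
    cycle, against maximality.\<close>
  have xy: "(x, y) \<in> conn E" if "x \<in> S" "y \<in> U" for x y
  proof (rule ccontr)
    assume nc: "(x, y) \<notin> conn E"
    have "insert {x, y} E \<in> ?A"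
      using acyclic_insert_of_not_conn[OF E(2) nc] E(1) that by (auto simp: bipartite_edges_def)
    then have "{x, y} \<in> E" using max[of "insert {x, y} E"] by blast
    then show False using nc edge_conn by metis
  qed
  obtain x0 y0 where 0: "x0 \<in> S" "y0 \<in> U" using ne by blast
  have "(u, x0) \<in> conn E" if "u \<in> V" for u
    using that xy 0 by (metis Un_iff conn_commute rtrancl_trans)
  then have "graph_connected V E"
    unfolding graph_connected_def using ne by (metis conn_commute rtrancl_trans sup_eq_bot_iff)
  then have "is_tree V E"
    using E edge_props fin by (auto simp: is_tree_def simple_graph_def)
  then show ?thesis using that E(1) by blast
qed

text \<open>Guarantees that within the stated range \<open>tau\<close> is the count for an actual
  tree.\<close>

lemma exists_subtree_of_type:
  assumes "finite X" "finite Y" "X \<inter> Y = {}" "1 \<le> s" "s \<le> card X" "1 \<le> t" "t \<le> card Y"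
  obtains VT ET where "subtree_of_type X Y s t VT ET"
proof -
  obtain S where S: "S \<subseteq> X" "card S = s" using assms(5) obtain_subset_with_card_n by metis
  obtain U where U: "U \<subseteq> Y" "card U = t" using assms(7) obtain_subset_with_card_n by metis
  have "finite S" "finite U" "S \<noteq> {}" "U \<noteq> {}" "S \<inter> U = {}"
    using S U assms by (auto intro: finite_subset)
  then obtain E where E: "E \<subseteq> bipartite_edges S U" "is_tree (S \<union> U) E"
    by (rule exists_bipartite_tree)
  have "(S \<union> U) \<inter> X = S" "(S \<union> U) \<inter> Y = U" using S U assms(3) by auto
  moreover have "bipartite_edges S U \<subseteq> bipartite_edges X Y"
    using S(1) U(1) by (auto simp: bipartite_edges_def)
  ultimately have "subtree_of_type X Y s t (S \<union> U) E"
    using E S U by (auto simp: subtree_of_type_def is_subgraph_def)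
  then show ?thesis by (rule that)
qed

section \<open>Well-definedness and closed form of \<open>tau\<close>\<close>

text \<open>Settles the types outside the closed formula: a tree missing one side has no edges, so
  all trees of such a type impose the same condition.\<close>

lemma subtree_of_type_degenerate:
  assumes T: "subtree_of_type X Y s t VT ET" and "s = 0 \<or> t = 0"
  shows "ET = {}"
proof (rule ccontr)
  assume "ET \<noteq> {}"
  then obtain e where e: "e \<in> ET" by blast
  have f: "finite VT" "e \<subseteq> VT" "e \<in> bipartite_edges X Y"
    using T e by (auto simp: subtree_of_type_def is_tree_def simple_graph_def is_subgraph_def)
  then obtain x y where "x \<in> VT \<inter> X" "y \<in> VT \<inter> Y" by (auto simp: bipartite_edges_def)
  then have "card (VT \<inter> X) > 0" "card (VT \<inter> Y) > 0" using f(1) by (auto simp: card_gt_0_iff)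
  then show False using T assms(2) by (auto simp: subtree_of_type_def)
qed

text \<open>For positive \<open>s\<close> and \<open>t\<close> the closed formula involves only the
  type, and its factor \<open>card X * card Y\<close> can be cancelled.\<close>

lemma num_spanning_trees_containing_unique:
  assumes fin: "finite X" "finite Y" and disj: "X \<inter> Y = {}"
    and T: "subtree_of_type X Y s t VT ET" and T': "subtree_of_type X Y s t VT' ET'"
  shows "num_spanning_trees_containing X Y ET = num_spanning_trees_containing X Y ET'"
proof (cases "s = 0 \<or> t = 0")
  case True
  then show ?thesis using subtree_of_type_degenerate T T' by metis
next
  case False
  then have st: "s \<ge> 1" "t \<ge> 1" by auto
  have "X \<noteq> {}" "Y \<noteq> {}" using T False by (auto simp: subtree_of_type_def)
  then interpret complete_bipartite X Y using fin disj by unfold_locales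
  have "real (card X) * real (card Y) * real (num_spanning_trees_containing X Y ET) =
      real (card X) * real (card Y) * real (num_spanning_trees_containing X Y ET')"
    by (simp only: card_trees_containing_subtree[OF T st] card_trees_containing_subtree[OF T' st])
  then show ?thesis using card_X_pos card_Y_pos by simp
qed

lemma num_spanning_trees_containing_eq_tau:
  assumes "finite X" "finite Y" "X \<inter> Y = {}" "subtree_of_type X Y s t VT ET"
  shows "num_spanning_trees_containing X Y ET = tau X Y s t"
  unfolding tau_def
  by (rule the_equality[symmetric]) (use num_spanning_trees_containing_unique assms in blast)+

lemma tau_formula:
  assumes "finite X" "finite Y" "X \<inter> Y = {}" "1 \<le> s" "s \<le> card X" "1 \<le> t" "t \<le> card Y"
  shows "real (card X) * real (card Y) * real (tau X Y s t) =
    real (card Y) ^ (card X - s) * real (card X) ^ (card Y - t) *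
    (real s * real (card Y) + (real (card X) - real s) * real t)"
proof -
  obtain VT ET where T: "subtree_of_type X Y s t VT ET"
    using exists_subtree_of_type[OF assms] .
  interpret complete_bipartite X Y using assms by unfold_locales auto
  show ?thesis
    using card_trees_containing_subtree[OF T assms(4,6)]
    by (simp add: num_spanning_trees_containing_eq_tau[OF assms(1-3) T])
qed

section \<open>The two ratios\<close>

lemma tau_ratio_Y:
  assumes "finite X" "finite Y" "X \<inter> Y = {}" "1 \<le> s" "s \<le> card X" "1 \<le> t" "t < card Y"
  shows "real (tau X Y s (t + 1)) / real (tau X Y s t) =
    (real s * real (card Y) + (real (card X) - real s) * (real t + 1)) /
    (real (card X) * (real s * real (card Y) + (real (card X) - real s) * real t))"
proof -
  let ?m = "real (card X)" and ?n = "real (card Y)"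
  \<comment> \<open>\<open>D\<close> is the linear factor of the closed formula and \<open>c\<close>
    the factor common to \<open>t\<close> and \<open>t + 1\<close>. The power of \<open>?m\<close>
    is one higher at \<open>t\<close>, which puts \<open>?m\<close> into the denominator of the
    ratio.\<close>
  define D where "D t = real s * ?n + (?m - real s) * t" for t
  define c where "c = ?n ^ (card X - s) * ?m ^ (card Y - t - 1) / (?m * ?n)"
  have m: "?m > 0" and n: "?n > 0" using assms by auto
  have "card Y - t = Suc (card Y - t - 1)" using assms by simp
  then have "?m ^ (card Y - t) = ?m * ?m ^ (card Y - t - 1)" by (metis power_Suc)
  then have "?m * ?n * real (tau X Y s t) =
      ?n ^ (card X - s) * ?m ^ (card Y - t - 1) * (?m * D (real t))"
    using tau_formula[of X Y s t] assms by (simp add: D_def)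
  then have t0: "real (tau X Y s t) = c * (?m * D (real t))"
    using m n unfolding c_def times_divide_eq_left by (intro eq_divide_imp) (auto simp: mult_ac)
  have "?m * ?n * real (tau X Y s (t + 1)) =
      ?n ^ (card X - s) * ?m ^ (card Y - t - 1) * D (real t + 1)"
    using tau_formula[of X Y s "t + 1"] assms by (simp add: D_def add.commute)
  then have t1: "real (tau X Y s (t + 1)) = c * D (real t + 1)"
    using m n unfolding c_def times_divide_eq_left by (intro eq_divide_imp) (auto simp: mult_ac)
  have "c \<noteq> 0" using m n by (simp add: c_def)
  then show ?thesis unfolding t0 t1 by (simp add: D_def)
qed

lemma subtree_of_type_swap: "subtree_of_type Y X t s VT ET \<longleftrightarrow> subtree_of_type X Y s t VT ET"
  and num_spanning_trees_containing_swap: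
    "num_spanning_trees_containing Y X ET = num_spanning_trees_containing X Y ET"
proof -
  have "bipartite_edges Y X = bipartite_edges X Y"
    by (auto simp: bipartite_edges_def insert_commute)
  then show "subtree_of_type Y X t s VT ET \<longleftrightarrow> subtree_of_type X Y s t VT ET"
    "num_spanning_trees_containing Y X ET = num_spanning_trees_containing X Y ET"
    by (auto simp: subtree_of_type_def num_spanning_trees_containing_def Un_commute)
qed

lemma tau_swap: "tau Y X t s = tau X Y s t"
  by (simp add: tau_def subtree_of_type_swap num_spanning_trees_containing_swap)

theorem theorem4p1:
  fixes X Y :: "'a set" and m n :: nat
  assumes "finite X" and "finite Y" and "X \<inter> Y = {}"
    and "card X = m" and "card Y = n"
  shows "(\<forall>s t VT ET. subtree_of_type X Y s t VT ET \<longrightarrow>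
            num_spanning_trees_containing X Y ET = tau X Y s t) \<and>
         (\<forall>s t. 1 \<le> s \<and> s \<le> m \<and> 1 \<le> t \<and> t \<le> n - 1 \<longrightarrow>
            real (tau X Y s (t + 1)) / real (tau X Y s t) =
            (real s * real n + (real m - real s) * (real t + 1)) /
            (real m * (real s * real n + (real m - real s) * real t))) \<and>
         (\<forall>s t. 1 \<le> s \<and> s \<le> m - 1 \<and> 1 \<le> t \<and> t \<le> n \<longrightarrow>
            real (tau X Y (s + 1) t) / real (tau X Y s t) =
            (real t * real m + (real n - real t) * (real s + 1)) /
            (real n * (real t * real m + (real n - real t) * real s)))"
proof (intro conjI allI impI)
  show "num_spanning_trees_containing X Y ET = tau X Y s t"
    if "subtree_of_type X Y s t VT ET" for s t VT ET
    using num_spanning_trees_containing_eq_tau[OF assms(1-3) that] .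
  show "real (tau X Y s (t + 1)) / real (tau X Y s t) =
      (real s * real n + (real m - real s) * (real t + 1)) /
      (real m * (real s * real n + (real m - real s) * real t))"
    if "1 \<le> s \<and> s \<le> m \<and> 1 \<le> t \<and> t \<le> n - 1" for s t
    \<comment> \<open>With truncated subtraction, \<open>1 \<le> t\<close> and
      \<open>t \<le> n - 1\<close> still force \<open>t < n\<close>.\<close>
    using tau_ratio_Y[of X Y s t] that assms by auto
  show "real (tau X Y (s + 1) t) / real (tau X Y s t) =
      (real t * real m + (real n - real t) * (real s + 1)) /
      (real n * (real t * real m + (real n - real t) * real s))"
    if "1 \<le> s \<and> s \<le> m - 1 \<and> 1 \<le> t \<and> t \<le> n" for s t
    \<comment> \<open>The second ratio is the first one with the two sides of the bipartition
      exchanged.\<close>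
    using tau_ratio_Y[of Y X t s] that assms by (auto simp: tau_swap[of Y X] Int_commute)
qed

end
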